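(* Let $\alpha,\beta,\sigma>0$ and $\mu\in\mathbb{R}$. If the distribution $\mathrm{BN}(\alpha,\beta,\mu,\sigma)$ has a mode at $z_0\in\mathbb{R}$, then the distribution $\mathrm{BN}(\beta,\alpha,\mu,\sigma)$ has a mode at $-z_0$, where mode locations are expressed in the standardized variable $z=(x-\mu)/\sigma$.
   Context: $\Phi$ and $\phi$ denote the standard normal cumulative distribution function and density, and $\mathrm{B}(\cdot,\cdot)$ is the beta function. The beta normal distribution $\mathrm{BN}(\alpha,\beta,\mu,\sigma)$ has density $$f(x)=\frac{1}{\sigma\,\mathrm{B}(\alpha,\beta)}\left[\Phi\left(\frac{x-\mu}{\sigma}\right)\right]^{\alpha-1}\left[1-\Phi\left(\frac{x-\mu}{\sigma}\right)\right]^{\beta-1}\phi\left(\frac{x-\mu}{\sigma}\right),\qquad x\in\mathbb{R}.$$ Saying that $\mathrm{BN}(\alpha,\beta,\mu,\sigma)$ has a mode at $z_0$ (in the standardized variable $z=(x-\mu)/\sigma$) means that the point $x_0=\mu+\sigma z_0$ is a critical point of $f$, $f'(x_0)=0$, with non-positive second derivative, $f''(x_0)\le 0$. *)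

theory Defs
  imports "HOL-Probability.Probability"
begin

definition std_normal_cdf :: "real \<Rightarrow> real" where
  "std_normal_cdf x = cdf std_normal_distribution x"

definition beta_normal_density ::
    "real \<Rightarrow> real \<Rightarrow> real \<Rightarrow> real \<Rightarrow> real \<Rightarrow> real" where
  "beta_normal_density \<alpha> \<beta> \<mu> \<sigma> x =
     1 / (\<sigma> * Beta \<alpha> \<beta>)
       * std_normal_cdf ((x - \<mu>) / \<sigma>) powr (\<alpha> - 1)
       * (1 - std_normal_cdf ((x - \<mu>) / \<sigma>)) powr (\<beta> - 1)
       * std_normal_density ((x - \<mu>) / \<sigma>)"

(* Derivatives are required to exist, rather than read off the total function deriv:
   f' is the derivative of f near x, and f'' that of f' at x. *)
definition has_mode_at :: "(real \<Rightarrow> real) \<Rightarrow> real \<Rightarrow> bool" where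
  "has_mode_at f x \<longleftrightarrow>
     (\<exists>f' f''. (\<forall>\<^sub>F y in nhds x. (f has_real_derivative f' y) (at y)) \<and> f' x = 0 \<and>
        (f' has_real_derivative f'') (at x) \<and> f'' \<le> 0)"

(* z is the location of the mode in the standardized variable (x - \<mu>) / \<sigma>. *)
definition beta_normal_has_mode ::
    "real \<Rightarrow> real \<Rightarrow> real \<Rightarrow> real \<Rightarrow> real \<Rightarrow> bool" where
  "beta_normal_has_mode \<alpha> \<beta> \<mu> \<sigma> z \<longleftrightarrow>
     has_mode_at (beta_normal_density \<alpha> \<beta> \<mu> \<sigma>) (\<mu> + \<sigma> * z)"

end

theory Submission
  imports Defs
begin

text \<open>
  The standard normal law is invariant under \<open>x \<mapsto> -x\<close> and has no atoms, so
  \<open>\<Phi>(-z) = 1 - \<Phi>(z)\<close>. Replacing \<open>z\<close> by \<open>-z\<close> therefore exchanges the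
  factors \<open>\<Phi>(z)\<close> and \<open>1 - \<Phi>(z)\<close> of the beta normal density, which has the same
  effect as exchanging their exponents; since \<open>\<phi>\<close> is even and the beta function is
  symmetric, the densities of \<open>BN(\<beta>, \<alpha>, \<mu>, \<sigma>)\<close> and
  \<open>BN(\<alpha>, \<beta>, \<mu>, \<sigma>)\<close> are mirror images of each other about \<open>\<mu>\<close>
  (lemma \<open>beta_normal_density_reflect\<close>). A reflection of the line carries modes to
  modes (lemma \<open>has_mode_at_reflect\<close>), and the reflection about \<open>\<mu>\<close> acts as
  \<open>z \<mapsto> -z\<close> on the standardized variable.
\<close>

text \<open>
  Each differentiation of \<open>y \<mapsto> f (c - y)\<close> contributes a factor \<open>-1\<close>: the first
  derivative changes sign, which does not affect its zeros, and the second keeps its sign.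
\<close>

lemma has_mode_at_reflect:
  assumes "has_mode_at f x"
  shows "has_mode_at (\<lambda>y. f (c - y)) (c - x)"
proof -
  obtain f' f'' where ev: "\<forall>\<^sub>F y in nhds x. (f has_real_derivative f' y) (at y)"
    and f'x: "f' x = 0" and f'': "(f' has_real_derivative f'') (at x)" and "f'' \<le> 0"
    using assms unfolding has_mode_at_def by blast
  have refl: "((\<lambda>y. h (c - y)) has_real_derivative - D) (at y)"
    if "(h has_real_derivative D) (at (c - y))" for h D y
  proof -
    have "((\<lambda>y. c - y) has_real_derivative -1) (at y)"
      by (auto intro!: derivative_eq_intros)
    from DERIV_chain2[OF that this] show ?thesis by simp
  qed
  have "filterlim (\<lambda>y. c - y) (nhds x) (nhds (c - x))"
    by (rule tendsto_eq_intros filterlim_ident | simp)+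
  from eventually_compose_filterlim[OF ev this]
  have "\<forall>\<^sub>F y in nhds (c - x). ((\<lambda>y. f (c - y)) has_real_derivative - f' (c - y)) (at y)"
    by eventually_elim (rule refl)
  moreover have "((\<lambda>y. - f' (c - y)) has_real_derivative f'') (at (c - x))"
    using DERIV_minus[OF refl[of f' f'' "c - x"]] f'' by simp
  ultimately show ?thesis
    unfolding has_mode_at_def using f'x \<open>f'' \<le> 0\<close>
    by (intro exI[of _ "\<lambda>y. - f' (c - y)"] exI[of _ f'']) simp
qed

text \<open>
  The affine map \<open>x \<mapsto> 0 + (-1) x\<close> turns mean \<open>0\<close> and standard deviation
  \<open>1\<close> into mean \<open>0\<close> and standard deviation \<open>\<bar>-1\<bar> = 1\<close>.
\<close>

lemma distr_std_normal_uminus: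
  "distr std_normal_distribution borel uminus = std_normal_distribution"
proof -
  interpret prob_space std_normal_distribution by (rule prob_space_normal_density) simp
  have "distributed std_normal_distribution lborel (\<lambda>x. x) std_normal_density"
    by (auto simp: distributed_def distr_id2)
  from normal_density_affine[OF this, of "-1" 0]
  have "distr std_normal_distribution lborel uminus = std_normal_distribution"
    by (simp add: distributed_def)
  moreover have "distr std_normal_distribution borel uminus
      = distr std_normal_distribution lborel uminus"
    by (rule distr_cong) auto
  ultimately show ?thesis by simp
qed

text \<open>
  By symmetry the mass of \<open>{..- z}\<close> is that of \<open>{z..}\<close>, which differs from the
  complement of \<open>{..z}\<close> only by the null set \<open>{z}\<close>.
\<close>

lemma std_normal_cdf_uminus: "std_normal_cdf (- z) = 1 - std_normal_cdf z"
proof -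
  let ?N = std_normal_distribution
  interpret prob_space ?N by (rule prob_space_normal_density) simp
  have "emeasure ?N {z} = 0" 
    by (simp add: emeasure_density nn_integral_indicator_singleton)
  then have atom: "prob {z} = 0"
    by (simp add: measure_def)
  have "uminus -` {..- z} = {z..}" by auto
  then have "prob {..- z} = prob {z..}"
    using measure_distr[of uminus ?N borel "{..- z}"] by (simp add: distr_std_normal_uminus)
  also have "\<dots> = prob {z} + prob {z<..}"
    by (subst finite_measure_Union[symmetric]) (auto intro!: arg_cong[of _ _ prob])
  also have "prob {z<..} = 1 - prob {..z}"
    using prob_compl[of "{..z}"] by (simp add: Compl_eq_Diff_UNIV[symmetric])
  finally show ?thesis
    by (simp add: std_normal_cdf_def cdf_def atom)
qed

lemma beta_normal_density_reflect:
  "beta_normal_density \<beta> \<alpha> \<mu> \<sigma> x = beta_normal_density \<alpha> \<beta> \<mu> \<sigma> (2 * \<mu> - x)"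
proof -
  have "(2 * \<mu> - x - \<mu>) / \<sigma> = - ((x - \<mu>) / \<sigma>)"
    by (simp add: minus_divide_left)
  then show ?thesis
    by (simp add: beta_normal_density_def std_normal_cdf_uminus std_normal_density_def
        Beta_commute[of \<beta> \<alpha>])
qed

theorem proposition3:
  fixes \<alpha> \<beta> \<mu> \<sigma> z\<^sub>0 :: real
  assumes "\<alpha> > 0" and "\<beta> > 0" and "\<sigma> > 0"
    and "beta_normal_has_mode \<alpha> \<beta> \<mu> \<sigma> z\<^sub>0"
  shows "beta_normal_has_mode \<beta> \<alpha> \<mu> \<sigma> (- z\<^sub>0)"
proof -
  have "2 * \<mu> - (\<mu> + \<sigma> * z\<^sub>0) = \<mu> + \<sigma> * (- z\<^sub>0)" by simp
  moreover have "beta_normal_density \<beta> \<alpha> \<mu> \<sigma> = (\<lambda>x. beta_normal_density \<alpha> \<beta> \<mu> \<sigma> (2 * \<mu> - x))"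
    by (rule ext) (rule beta_normal_density_reflect)
  ultimately show ?thesis
    using has_mode_at_reflect[of _ _ "2 * \<mu>"] assms(4) unfolding beta_normal_has_mode_def by metis
qed

end
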